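(* Let $ABC$ be a triangle with circumcircle $k(O,R)$. Let $\Omega_1,\Omega_2$ be its first and second Brocard points, and let $L_1,L_2,L_3$ be the points whose pedal triangles $A_1B_1C_1$ are positively oriented and satisfy $\triangle A_1B_1C_1\sim\triangle ACB$ (for $L_1$), $\triangle A_1B_1C_1\sim\triangle CBA$ (for $L_2$), $\triangle A_1B_1C_1\sim\triangle BAC$ (for $L_3$). Let $\Omega'_1,\Omega'_2,L'_1,L'_2,L'_3$ be the inverse points of $\Omega_1,\Omega_2,L_1,L_2,L_3$, respectively, with respect to the circle $k$. Then the points $\Omega'_1,\Omega'_2,L'_1,L'_2,L'_3$, whose pedal triangles are negatively oriented and similar to $\triangle ABC$, lie on a single straight line.
   Context: For a point $M$ of the plane not on $k$, its pedal triangle is $A_1B_1C_1$, where $A_1,B_1,C_1$ are the orthogonal projections of $M$ on the lines $BC,CA,AB$, respectively. It is called positively oriented if the ordered triple $A_1,B_1,C_1$ has the same orientation as $A,B,C$, and negatively oriented if it has the opposite orientation. A similarity written with named vertices respects their order (e.g. $\triangle A_1B_1C_1\sim\triangle BAC$ means that the angles at $A_1,B_1,C_1$ equal $\angle B,\angle A,\angle C$, respectively); "similar to $\triangle ABC$" without such a specification means similar in some order of the vertices. For each prescribed triple of angles of a triangle there is exactly one point inside $k$ whose pedal triangle has these angles at $A_1,B_1,C_1$, and the points inside $k$ are exactly those with positively oriented pedal triangles; this makes $L_1,L_2,L_3$ well defined. The first Brocard point $\Omega_1$ is the point inside $\triangle ABC$ with $\angle\Omega_1AB=\angle\Omega_1BC=\angle\Omega_1CA$;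 the second Brocard point $\Omega_2$ is the point inside $\triangle ABC$ with $\angle\Omega_2AC=\angle\Omega_2CB=\angle\Omega_2BA$. Their pedal triangles are positively oriented and similar to $\triangle BCA$ and $\triangle CAB$, respectively. The inverse of a point $M\neq O$ with respect to $k$ is the point $M'$ on the ray $OM$ with $OM\cdot OM'=R^2$. If $CA=CB$ (isosceles $\triangle ABC$), the line in the claim is parallel to $AB$ and $L'_3$ is the point at infinity of the line $AB$; similarly for $L'_1$ and the line $BC$ if $AB=AC$, and for $L'_2$ and the line $CA$ if $BC=BA$.
   Formalization: The triangle ABC is assumed not equilateral: in an equilateral triangle both Brocard points and L_1, L_2, L_3 all equal O, so the inverse points of the Brocard points do not exist. *)

theory Defs
  imports "HOL-Analysis.Analysis"
begin

text \<open>The Euclidean plane is the type of complex numbers with its real inner product.\<close>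

text \<open>\<open>angle P V Q\<close> is the unoriented angle with vertex \<open>V\<close>, in \<open>[0, \<pi>]\<close>; it is meaningful
  only for \<open>P \<noteq> V\<close> and \<open>Q \<noteq> V\<close>.\<close>

definition angle :: "complex \<Rightarrow> complex \<Rightarrow> complex \<Rightarrow> real" where
  "angle P V Q = arccos (((P - V) \<bullet> (Q - V)) / (norm (P - V) * norm (Q - V)))"

text \<open>The imaginary part is twice the signed area of \<open>PQR\<close>: the value is \<open>1\<close> for a
  counterclockwise triple, \<open>-1\<close> for a clockwise one, \<open>0\<close> for a collinear one.\<close>

definition orientation :: "complex \<Rightarrow> complex \<Rightarrow> complex \<Rightarrow> real" where
  "orientation P Q R = sgn (Im (cnj (Q - P) * (R - P)))"

definition similar_triangles ::
  "complex \<Rightarrow> complex \<Rightarrow> complex \<Rightarrow> complex \<Rightarrow> complex \<Rightarrow> complex \<Rightarrow> bool" where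
  "similar_triangles P Q R X Y Z \<longleftrightarrow>
     \<not> collinear {P, Q, R} \<and> \<not> collinear {X, Y, Z} \<and>
     angle Q P R = angle Y X Z \<and> angle R Q P = angle Z Y X \<and> angle P R Q = angle X Z Y"

text \<open>Similar in some order of the vertices: \<open>X, Y, Z\<close> is a permutation of \<open>A, B, C\<close>, since
  these three points are distinct whenever the triangles are not degenerate.\<close>

definition similar_some_order ::
  "complex \<Rightarrow> complex \<Rightarrow> complex \<Rightarrow> complex \<Rightarrow> complex \<Rightarrow> complex \<Rightarrow> bool" where
  "similar_some_order P Q R A B C \<longleftrightarrow>
     (\<exists>X Y Z. {X, Y, Z} = {A, B, C} \<and> similar_triangles P Q R X Y Z)"

text \<open>Orthogonal projection of \<open>M\<close> on the line \<open>PQ\<close>, for \<open>P \<noteq> Q\<close>.\<close>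

definition foot :: "complex \<Rightarrow> complex \<Rightarrow> complex \<Rightarrow> complex" where
  "foot M P Q = (THE F. F \<in> affine hull {P, Q} \<and> orthogonal (M - F) (Q - P))"

definition pedal_positive :: "complex \<Rightarrow> complex \<Rightarrow> complex \<Rightarrow> complex \<Rightarrow> bool" where
  "pedal_positive A B C M \<longleftrightarrow>
     orientation (foot M B C) (foot M C A) (foot M A B) = orientation A B C"

definition pedal_negative :: "complex \<Rightarrow> complex \<Rightarrow> complex \<Rightarrow> complex \<Rightarrow> bool" where
  "pedal_negative A B C M \<longleftrightarrow>
     orientation (foot M B C) (foot M C A) (foot M A B) = - orientation A B C"

definition pedal_similar ::
  "complex \<Rightarrow> complex \<Rightarrow> complex \<Rightarrow> complex \<Rightarrow> complex \<Rightarrow> complex \<Rightarrow> complex \<Rightarrow> bool" where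
  "pedal_similar A B C M X Y Z \<longleftrightarrow>
     similar_triangles (foot M B C) (foot M C A) (foot M A B) X Y Z"

definition pedal_similar_some_order ::
  "complex \<Rightarrow> complex \<Rightarrow> complex \<Rightarrow> complex \<Rightarrow> bool" where
  "pedal_similar_some_order A B C M \<longleftrightarrow>
     similar_some_order (foot M B C) (foot M C A) (foot M A B) A B C"

definition first_brocard :: "complex \<Rightarrow> complex \<Rightarrow> complex \<Rightarrow> complex \<Rightarrow> bool" where
  "first_brocard A B C W \<longleftrightarrow>
     W \<in> interior (convex hull {A, B, C}) \<and>
     angle W A B = angle W B C \<and> angle W B C = angle W C A"

definition second_brocard :: "complex \<Rightarrow> complex \<Rightarrow> complex \<Rightarrow> complex \<Rightarrow> bool" where
  "second_brocard A B C W \<longleftrightarrow>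
     W \<in> interior (convex hull {A, B, C}) \<and>
     angle W A C = angle W C B \<and> angle W C B = angle W B A"

text \<open>The inverse of \<open>M \<noteq> Z\<close> in the circle with centre \<open>Z\<close> and radius \<open>R\<close>.\<close>

definition inverse_point :: "complex \<Rightarrow> real \<Rightarrow> complex \<Rightarrow> complex" where
  "inverse_point Z R M =
     (THE N. (\<exists>t\<ge>0. N = Z + t *\<^sub>R (M - Z)) \<and> dist Z M * dist Z N = R\<^sup>2)"

definition is_line :: "complex set \<Rightarrow> bool" where
  "is_line l \<longleftrightarrow> (\<exists>P Q. P \<noteq> Q \<and> l = affine hull {P, Q})"

definition parallel_lines :: "complex set \<Rightarrow> complex set \<Rightarrow> bool" where
  "parallel_lines l m \<longleftrightarrow> is_line l \<and> is_line m \<and> affine_parallel l m \<and> l \<noteq> m"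

text \<open>The descriptions in \<open>foot\<close> and \<open>inverse_point\<close> each determine exactly one point.\<close>

lemma foot_unique:
  fixes M P Q :: complex
  assumes "P \<noteq> Q"
  shows "\<exists>!F. F \<in> affine hull {P, Q} \<and> orthogonal (M - F) (Q - P)"
proof -
  let ?t = "((M - P) \<bullet> (Q - P)) / ((Q - P) \<bullet> (Q - P))"
  have nz: "(Q - P) \<bullet> (Q - P) \<noteq> 0" using assms by simp
  have mem: "F \<in> affine hull {P, Q} \<longleftrightarrow> (\<exists>t. F = P + t *\<^sub>R (Q - P))" for F
    unfolding affine_hull_2_alt by auto
  have orth: "orthogonal (M - (P + t *\<^sub>R (Q - P))) (Q - P) \<longleftrightarrow> t = ?t" for t
  proof -
    have "(M - (P + t *\<^sub>R (Q - P))) \<bullet> (Q - P) =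
        (M - P) \<bullet> (Q - P) - t * ((Q - P) \<bullet> (Q - P))"
      by (simp add: inner_diff_left inner_add_left)
    then show ?thesis unfolding orthogonal_def using nz by (auto simp: field_simps)
  qed
  show ?thesis
  proof (rule ex1I[of _ "P + ?t *\<^sub>R (Q - P)"])
    show "P + ?t *\<^sub>R (Q - P) \<in> affine hull {P, Q} \<and>
        orthogonal (M - (P + ?t *\<^sub>R (Q - P))) (Q - P)"
      using mem orth by blast
  next
    fix F assume "F \<in> affine hull {P, Q} \<and> orthogonal (M - F) (Q - P)"
    then show "F = P + ?t *\<^sub>R (Q - P)" using mem orth by metis
  qed
qed

lemma inverse_point_unique:
  fixes M Z :: complex
  assumes "M \<noteq> Z"
  shows "\<exists>!N. (\<exists>t\<ge>0. N = Z + t *\<^sub>R (M - Z)) \<and> dist Z M * dist Z N = R\<^sup>2"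
proof -
  let ?d = "dist Z M"
  have nz: "?d > 0" using assms by simp
  have d: "?d * dist Z (Z + t *\<^sub>R (M - Z)) = t * ?d\<^sup>2" if "t \<ge> 0" for t
  proof -
    have "dist Z (Z + t *\<^sub>R (M - Z)) = norm (t *\<^sub>R (M - Z))"
      by (metis add_diff_cancel_left' dist_commute dist_norm)
    also have "\<dots> = t * ?d"
      using that by (simp add: dist_norm norm_minus_commute)
    finally show ?thesis by (simp add: power2_eq_square)
  qed
  have iff: "?d * dist Z (Z + t *\<^sub>R (M - Z)) = R\<^sup>2 \<longleftrightarrow> t = R\<^sup>2 / ?d\<^sup>2" if "t \<ge> 0" for t
    unfolding d[OF that] using nz by (auto simp: field_simps)
  show ?thesis
  proof (rule ex1I[of _ "Z + (R\<^sup>2 / ?d\<^sup>2) *\<^sub>R (M - Z)"])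
    show "(\<exists>t\<ge>0. Z + (R\<^sup>2 / ?d\<^sup>2) *\<^sub>R (M - Z) = Z + t *\<^sub>R (M - Z)) \<and>
        ?d * dist Z (Z + (R\<^sup>2 / ?d\<^sup>2) *\<^sub>R (M - Z)) = R\<^sup>2"
      using iff[of "R\<^sup>2 / ?d\<^sup>2"] by (auto intro!: exI[of _ "R\<^sup>2 / ?d\<^sup>2"])
  next
    fix N assume "(\<exists>t\<ge>0. N = Z + t *\<^sub>R (M - Z)) \<and> ?d * dist Z N = R\<^sup>2"
    then show "N = Z + (R\<^sup>2 / ?d\<^sup>2) *\<^sub>R (M - Z)" using iff by metis
  qed
qed

end

theory Submission
  imports Defs
begin

text \<open>
  The common line is the Lemoine axis of \<open>ABC\<close>, the polar of the symmedian point with respect to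
  the circumcircle. Complex coordinates with the circumcircle as unit circle make this a short
  computation: the vertices become unimodular numbers \<open>a, b, c\<close>, so that conjugation acts on them
  as \<open>a \<mapsto> 1 / a\<close>, and the inverse of \<open>m\<close> is \<open>1 / cnj m\<close>.

  The complex number \<open>shape P Q R = (R - P) / (Q - P)\<close> determines the triangle \<open>PQR\<close> up to an
  orientation preserving similarity: triangles of equal orientation are similar iff their shapes
  agree, and triangles of opposite orientation are similar iff their shapes are conjugate
  (\<open>similar_imp_shape_eq\<close>, \<open>shape_eq_imp_similar\<close>, and their conjugate forms). The shape of the
  pedal triangle of \<open>m\<close> is \<open>(c - a) (1 - b cnj m) / ((b - a) (1 - c cnj m))\<close> (\<open>pedal_shape\<close>), a
  Moebius function of \<open>cnj m\<close>. Two consequences carry the proof.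

  Replacing \<open>m\<close> by \<open>1 / cnj m\<close> conjugates this shape. Hence an inverse point has the pedal
  triangle of the original point up to an orientation reversing similarity
  (\<open>pedal_triangle_inverse\<close>).

  Prescribing the shape determines \<open>cnj m\<close> as a rational function of \<open>a, b, c\<close>. For \<open>L1\<close> the
  inverse point turns out to be the intersection of \<open>BC\<close> with the tangent at \<open>A\<close>, which runs off
  to infinity exactly when \<open>AB = AC\<close>. For \<open>\<Omega>1\<close> the condition of equal angles places the point on
  three circles, and the sum of their equations is linear in \<open>cnj m\<close> alone. In both cases the
  inverse satisfies one real-linear equation that is symmetric in \<open>a, b, c\<close>
  (\<open>reversed_pedal_point\<close>, \<open>brocard_point\<close>). By this symmetry \<open>L2\<close> and \<open>L3\<close> follow from \<open>L1\<close> by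
  rotating the names of the vertices, and \<open>\<Omega>2\<close> from \<open>\<Omega>1\<close> by exchanging \<open>B\<close> and \<open>C\<close>. The equation
  degenerates only for an equilateral triangle, so its solutions form a line.
\<close>

section \<open>Shapes of triangles\<close>

definition shape :: "complex \<Rightarrow> complex \<Rightarrow> complex \<Rightarrow> complex" where
  "shape P Q R = (R - P) / (Q - P)"

lemma Im_cnj_mult_quotient: "Im (cnj u * v) = (norm u)\<^sup>2 * Im (v / u)"
proof (cases "u = 0")
  case False
  have "cnj u * v = of_real ((norm u)\<^sup>2) * (v / u)"
    using False by (simp add: complex_norm_square field_simps del: of_real_power)
  then show ?thesis by (metis Im_complex_of_real Re_complex_of_real complex.sel(2)
    times_complex.simps(2) mult_zero_left add.right_neutral)
qed simp

lemma Re_cnj_mult_quotient: "Re (cnj u * v) = (norm u)\<^sup>2 * Re (v / u)"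
proof (cases "u = 0")
  case False
  have "cnj u * v = of_real ((norm u)\<^sup>2) * (v / u)"
    using False by (simp add: complex_norm_square field_simps del: of_real_power)
  then show ?thesis by (metis Im_complex_of_real Re_complex_of_real times_complex.simps(1)
    mult_zero_left diff_zero)
qed simp

lemma inner_eq_Re_cnj_mult: "x \<bullet> y = Re (cnj x * y)"
  by (simp add: inner_complex_def)

lemma orientation_eq_sgn_Im_shape: "orientation P Q R = sgn (Im (shape P Q R))"
  unfolding orientation_def shape_def Im_cnj_mult_quotient
  by (cases "Q = P") (auto simp: sgn_mult)

lemma orientation_cyclic: "orientation Q R P = orientation P Q R"
  by (simp add: orientation_def algebra_simps)

lemma orientation_swap: "orientation P R Q = - orientation P Q R"
proof -
  have "Im (cnj (R - P) * (Q - P)) = - Im (cnj (Q - P) * (R - P))"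
    by (simp add: algebra_simps)
  then show ?thesis unfolding orientation_def by (simp only: sgn_minus)
qed

lemma collinear_iff_orientation: "collinear {P, Q, R} \<longleftrightarrow> orientation P Q R = 0"
proof (cases "Q = P")
  case True
  then show ?thesis by (simp add: orientation_def)
next
  case False
  have "collinear {P, Q, R} \<longleftrightarrow> collinear {0, Q - P, R - P}"
    using collinear_3[of Q P R] by (simp add: insert_commute)
  also have "\<dots> \<longleftrightarrow> (\<exists>c. R - P = c *\<^sub>R (Q - P))"
    using False by (auto simp: collinear_lemma intro: exI[of _ "0::real"])
  also have "\<dots> \<longleftrightarrow> Im (shape P Q R) = 0"
  proof
    assume "\<exists>c. R - P = c *\<^sub>R (Q - P)"
    then show "Im (shape P Q R) = 0" using False by (auto simp: shape_def scaleR_conv_of_real)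
  next
    assume "Im (shape P Q R) = 0"
    then have "shape P Q R = of_real (Re (shape P Q R))" by (simp add: complex_eq_iff)
    then show "\<exists>c. R - P = c *\<^sub>R (Q - P)" using False
      by (intro exI[of _ "Re (shape P Q R)"])
        (metis eq_iff_diff_eq_0 nonzero_eq_divide_eq scaleR_conv_of_real shape_def)
  qed
  finally show ?thesis by (simp add: orientation_eq_sgn_Im_shape sgn_zero_iff)
qed

definition unsigned_arg :: "complex \<Rightarrow> real" where
  "unsigned_arg z = arccos (Re z / norm z)"

lemma angle_eq_unsigned_arg_shape: "angle Q P R = unsigned_arg (shape P Q R)"
proof (cases "Q = P")
  case False
  have "(Q - P) \<bullet> (R - P) = (norm (Q - P))\<^sup>2 * Re (shape P Q R)"
    using Re_cnj_mult_quotient[of "Q - P" "R - P"] by (simp add: shape_def inner_eq_Re_cnj_mult)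
  then show ?thesis using False
    by (simp add: angle_def unsigned_arg_def shape_def norm_divide power2_eq_square divide_simps mult.commute)
qed (simp add: angle_def unsigned_arg_def shape_def)

lemma angle_commute: "angle Q P R = angle R P Q"
  by (simp add: angle_def inner_commute mult.commute)

lemma unsigned_arg_cnj [simp]: "unsigned_arg (cnj z) = unsigned_arg z"
  by (simp add: unsigned_arg_def)

text \<open>The angle at a vertex is the argument of a shape up to sign, and the orientation supplies the
  sign. Equal angles with equal orientations therefore give shapes on the same ray from the origin;
  this is how the hypotheses on angles become algebraic equations.\<close>

lemma same_direction:
  assumes "unsigned_arg z = unsigned_arg w" "sgn (Im z) = sgn (Im w)" "Im w \<noteq> 0"
  obtains t where "t > 0" "z = of_real t * w"
proof
  have nz: "z \<noteq> 0" "w \<noteq> 0" using assms(2,3) by (auto simp: sgn_zero_iff)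
  have bd: "\<bar>Re x / norm x\<bar> \<le> 1" for x :: complex
    using abs_Re_le_cmod[of x] by (cases "x = 0") (auto simp: divide_simps)
  have re: "Re z / norm z = Re w / norm w"
    using assms(1) bd[of z] bd[of w] unfolding unsigned_arg_def
    by (subst (asm) arccos_eq_iff) auto
  have sq: "(Im x / norm x)\<^sup>2 = 1 - (Re x / norm x)\<^sup>2" if "x \<noteq> 0" for x
  proof -
    have "(Im x)\<^sup>2 = (norm x)\<^sup>2 - (Re x)\<^sup>2" by (simp add: cmod_power2)
    then show ?thesis using that by (simp add: power_divide diff_divide_distrib)
  qed
  have "(Im z / norm z)\<^sup>2 = (Im w / norm w)\<^sup>2" using sq nz re by simp
  then have "\<bar>Im z / norm z\<bar> = \<bar>Im w / norm w\<bar>" by (simp only: power2_eq_iff abs_eq_iff)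
  moreover have "sgn (Im z / norm z) = sgn (Im w / norm w)"
    using assms(2) nz by (simp add: sgn_divide)
  ultimately have im: "Im z / norm z = Im w / norm w" by (metis sgn_mult_abs)
  show "norm z / norm w > 0" using nz by simp
  show "z = of_real (norm z / norm w) * w"
    using re im nz by (auto simp: complex_eq_iff field_simps)
qed

text \<open>The two other rotations of a triangle have a shape that depends only on the first one, so
  equality of the shapes at one vertex yields equality of all three angles.\<close>

lemma shape_cyclic:
  assumes "P \<noteq> Q"
  shows "shape Q R P = 1 / (1 - shape P Q R)" "shape R P Q = (shape P Q R - 1) / shape P Q R"
proof -
  have "shape P Q R - 1 = (R - Q) / (Q - P)"
    using assms by (simp add: shape_def divide_simps)
  then have e: "shape P Q R = (R - P) / (Q - P)" "1 - shape P Q R = - ((R - Q) / (Q - P))"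
    "shape P Q R - 1 = (R - Q) / (Q - P)"
    by (simp_all add: shape_def algebra_simps)
  show "shape Q R P = 1 / (1 - shape P Q R)"
    unfolding e(2) by (simp add: shape_def minus_divide_left[symmetric] flip: minus_divide_right)
      (metis minus_diff_eq minus_divide_left)
  show "shape R P Q = (shape P Q R - 1) / shape P Q R"
    unfolding e(3) unfolding e(1) using assms
    by (simp add: shape_def) (metis minus_diff_eq minus_divide_divide)
qed

lemma noncollinear_distinct:
  assumes "\<not> collinear {P, Q, R}"
  shows "P \<noteq> Q" "Q \<noteq> R" "P \<noteq> R"
  using assms by (auto simp: insert_commute)

lemma noncollinear_Im_shape:
  "\<not> collinear {P, Q, R} \<longleftrightarrow> Im (shape P Q R) \<noteq> 0"
  by (simp add: collinear_iff_orientation orientation_eq_sgn_Im_shape sgn_zero_iff)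

text \<open>The angle at \<open>P\<close> puts the shapes \<open>s, t\<close> on one ray from \<open>0\<close>, and the angle at \<open>Q\<close> puts
  \<open>1 - s, 1 - t\<close> on one ray. So \<open>s\<close> is on the line through \<open>0, t\<close> and on the line
  through \<open>1, t\<close>, which meet only in \<open>t\<close> because \<open>t\<close> is not real.\<close>

lemma similar_imp_shape_eq:
  assumes "similar_triangles P Q R X Y Z" "orientation P Q R = orientation X Y Z"
  shows "shape P Q R = shape X Y Z"
proof -
  have nc: "\<not> collinear {P, Q, R}" "\<not> collinear {X, Y, Z}"
    and ang: "angle Q P R = angle Y X Z" "angle R Q P = angle Z Y X"
    using assms(1) by (auto simp: similar_triangles_def)
  define s t where "s = shape P Q R" and "t = shape X Y Z"
  have im: "Im s \<noteq> 0" "Im t \<noteq> 0" using nc by (simp_all add: noncollinear_Im_shape s_def t_def)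
  have sg: "sgn (Im s) = sgn (Im t)"
    using assms(2) by (simp add: orientation_eq_sgn_Im_shape s_def t_def)
  have sq: "shape Q R P = 1 / (1 - s)" "shape Y Z X = 1 / (1 - t)"
    using shape_cyclic(1) nc[THEN noncollinear_distinct(1)] by (auto simp: s_def t_def)
  have sg': "sgn (Im (1 / (1 - s))) = sgn (Im (1 / (1 - t)))"
    using orientation_cyclic[of Q R P] orientation_cyclic[of Y Z X] assms(2)
    unfolding sq[symmetric] by (simp add: orientation_eq_sgn_Im_shape)
  have im': "Im (1 / (1 - t)) \<noteq> 0"
    using nc(2) orientation_cyclic[of Y Z X] unfolding sq[symmetric]
    by (metis collinear_iff_orientation orientation_eq_sgn_Im_shape sgn_zero_iff)
  obtain p where p: "s = of_real p * t"
    using same_direction[OF _ sg im(2)] ang(1) by (auto simp: angle_eq_unsigned_arg_shape s_def t_def)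
  obtain q where q: "1 / (1 - s) = of_real q * (1 / (1 - t))"
    using same_direction[OF _ sg' im'] ang(2)
    by (metis angle_eq_unsigned_arg_shape sq)
  have nz: "1 - s \<noteq> 0" "1 - t \<noteq> 0" using im by auto
  have e: "1 - t = of_real q * (1 - s)" using q nz by (simp add: field_simps)
  have "Im t = q * p * Im t" using arg_cong[OF e, of Im] p by simp
  then have qp: "q * p = 1" using im by simp
  have "1 - Re t = q - q * p * Re t" using arg_cong[OF e, of Re] p by (simp add: algebra_simps)
  then have "q = 1" using qp by simp
  then show ?thesis using qp p by (simp add: s_def t_def)
qed

text \<open>Conjugation is a reflection: it keeps unoriented angles and reverses orientations, which
  reduces the orientation reversing similarities to the preserving ones.\<close>

lemma shape_cnj: "shape (cnj P) (cnj Q) (cnj R) = cnj (shape P Q R)"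
  by (simp add: shape_def)

lemma orientation_cnj: "orientation (cnj P) (cnj Q) (cnj R) = - orientation P Q R"
  by (simp add: orientation_eq_sgn_Im_shape shape_cnj sgn_minus)

lemma similar_cnj:
  "similar_triangles P Q R (cnj X) (cnj Y) (cnj Z) \<longleftrightarrow> similar_triangles P Q R X Y Z"
  by (simp add: similar_triangles_def angle_eq_unsigned_arg_shape shape_cnj noncollinear_Im_shape)

lemma similar_imp_shape_eq_cnj:
  assumes "similar_triangles P Q R X Y Z" "orientation P Q R = - orientation X Y Z"
  shows "shape P Q R = cnj (shape X Y Z)"
  using similar_imp_shape_eq[of P Q R "cnj X" "cnj Y" "cnj Z"] assms
  by (simp add: similar_cnj orientation_cnj shape_cnj)

lemma shape_eq_imp_similar:
  assumes "\<not> collinear {X, Y, Z}" "shape P Q R = shape X Y Z"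
  shows "similar_triangles P Q R X Y Z"
proof -
  have nc: "\<not> collinear {P, Q, R}" using assms by (simp add: noncollinear_Im_shape)
  show ?thesis
    using assms nc nc[THEN noncollinear_distinct(1)] assms(1)[THEN noncollinear_distinct(1)]
    by (simp add: similar_triangles_def angle_eq_unsigned_arg_shape shape_cyclic)
qed

lemma shape_eq_cnj_imp_similar:
  assumes "\<not> collinear {X, Y, Z}" "shape P Q R = cnj (shape X Y Z)"
  shows "similar_triangles P Q R X Y Z"
  using shape_eq_imp_similar[of "cnj X" "cnj Y" "cnj Z" P Q R] assms
  by (simp add: similar_cnj shape_cnj noncollinear_Im_shape)

lemma similar_trans:
  assumes "similar_triangles P Q R P' Q' R'" "similar_triangles P' Q' R' X Y Z"
  shows "similar_triangles P Q R X Y Z"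
  using assms by (simp add: similar_triangles_def)

lemma similar_cyclic:
  "similar_triangles P Q R X Y Z \<Longrightarrow> similar_triangles Q R P Y Z X"
  by (simp add: similar_triangles_def angle_commute insert_commute)

lemma similar_swap:
  "similar_triangles P Q R X Y Z \<Longrightarrow> similar_triangles P R Q X Z Y"
  by (simp add: similar_triangles_def angle_commute insert_commute)

section \<open>Feet and inverse points in circumcircle coordinates\<close>

lemma cnj_unit: "norm a = 1 \<Longrightarrow> cnj a = 1 / a"
  using complex_norm_square[of a]
  by (metis nonzero_mult_div_cancel_left mult_zero_left of_real_1 one_power2 zero_neq_one)

text \<open>For unimodular \<open>b, c\<close> a point \<open>z\<close> lies on the line \<open>bc\<close> iff \<open>z + b c cnj z = b + c\<close>. Hence the
  reflection of \<open>m\<close> in this line is \<open>b + c - b c cnj m\<close>, and the foot is the midpoint of \<open>m\<close> and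
  its reflection.\<close>

lemma foot_chord:
  assumes "norm b = 1" "norm c = 1" "b \<noteq> c" "R \<noteq> 0"
  shows "foot (Z + of_real R * m) (Z + of_real R * b) (Z + of_real R * c) =
    Z + of_real R * ((b + c + m - b * c * cnj m) / 2)"
proof -
  let ?P = "Z + of_real R * b" and ?Q = "Z + of_real R * c" and ?M = "Z + of_real R * m"
  let ?f = "(b + c + m - b * c * cnj m) / 2"
  let ?F = "Z + of_real R * ?f"
  have nz: "b \<noteq> 0" "c \<noteq> 0" using assms by auto
  note cb = cnj_unit[OF assms(1)] cnj_unit[OF assms(2)]
  have PQ: "?P \<noteq> ?Q" using assms by simp
  \<comment> \<open>A number equal to its conjugate is real, so the foot lies on the line \<open>bc\<close>.\<close>
  define t where "t = (?f - b) / (c - b)"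
  have "cnj t = t" using assms(3) nz unfolding t_def by (simp add: cb field_simps)
  then have tr: "t = of_real (Re t)" by (simp add: complex_eq_iff)
  have f: "?f = b + t * (c - b)" using assms(3) by (simp add: t_def)
  have "?F = ?P + of_real (Re t) * (?Q - ?P)"
    unfolding f tr[symmetric] by (simp add: algebra_simps)
  then have mem: "?F \<in> affine hull {?P, ?Q}"
    unfolding affine_hull_2_alt by (auto simp: scaleR_conv_of_real)
  \<comment> \<open>A number equal to minus its conjugate is imaginary, so the projecting line is a normal.\<close>
  define E where "E = cnj (m - ?f) * (c - b)"
  have "cnj E = - E" using nz unfolding E_def by (simp add: cb field_simps)
  then have "Re E = 0" by (simp add: complex_eq_iff)
  moreover have "cnj (?M - ?F) * (?Q - ?P) = of_real (R * R) * E"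
    by (simp add: E_def algebra_simps)
  ultimately have "Re (cnj (?M - ?F) * (?Q - ?P)) = 0" by simp
  then have "orthogonal (?M - ?F) (?Q - ?P)"
    unfolding orthogonal_def inner_eq_Re_cnj_mult .
  then show ?thesis unfolding foot_def
    using the1_equality[OF foot_unique[OF PQ]] mem by blast
qed

text \<open>In the differences of the feet the terms without \<open>cnj m\<close> and those with \<open>cnj m\<close> share a factor:
  the side from \<open>A\<^sub>1\<close> to \<open>B\<^sub>1\<close> is \<open>(a - b) (1 - c cnj m) / 2\<close> times the radius, and the other sides follow by rotation.\<close>

lemma pedal_shape:
  assumes "norm a = 1" "norm b = 1" "norm c = 1" "a \<noteq> b" "b \<noteq> c" "c \<noteq> a" "R \<noteq> 0"
    and "A = Z + of_real R * a" "B = Z + of_real R * b" "C = Z + of_real R * c" "M = Z + of_real R * m"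
  shows "shape (foot M B C) (foot M C A) (foot M A B) =
    (c - a) * (1 - b * cnj m) / ((b - a) * (1 - c * cnj m))"
proof -
  have f: "foot M B C = Z + of_real R * ((b + c + m - b * c * cnj m) / 2)"
     "foot M C A = Z + of_real R * ((c + a + m - c * a * cnj m) / 2)"
     "foot M A B = Z + of_real R * ((a + b + m - a * b * cnj m) / 2)"
    using foot_chord assms by auto
  have "foot M C A - foot M B C = - of_real R / 2 * ((b - a) * (1 - c * cnj m))"
    "foot M A B - foot M B C = - of_real R / 2 * ((c - a) * (1 - b * cnj m))"
    unfolding f by (simp_all add: field_simps)
  then show ?thesis unfolding shape_def using assms(7) by (simp add: mult_divide_mult_cancel_left)
qed

lemma inverse_point_normalised:
  assumes "R > 0" "m \<noteq> 0"
  shows "inverse_point Z R (Z + of_real R * m) = Z + of_real R * (1 / cnj m)"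
proof -
  let ?M = "Z + of_real R * m" and ?N = "Z + of_real R * (1 / cnj m)"
  have ne: "?M \<noteq> Z" using assms by simp
  have "of_real (1 / (norm m)\<^sup>2) * m = 1 / cnj m"
    using assms(2) by (simp add: complex_norm_square field_simps del: of_real_power)
  then have "?N = Z + (1 / (norm m)\<^sup>2) *\<^sub>R (?M - Z)"
    by (simp add: scaleR_conv_of_real mult.left_commute)
  moreover have "dist Z ?M * dist Z ?N = R\<^sup>2"
    using assms by (simp add: dist_norm norm_mult norm_divide power2_eq_square)
  ultimately have "(\<exists>t\<ge>0. ?N = Z + t *\<^sub>R (?M - Z)) \<and> dist Z ?M * dist Z ?N = R\<^sup>2"
    by (intro conjI exI[of _ "1 / (norm m)\<^sup>2"]) auto
  then show ?thesis unfolding inverse_point_def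
    using the1_equality[OF inverse_point_unique[OF ne]] by blast
qed

section \<open>The Lemoine axis of a triangle inscribed in the unit circle\<close>

text \<open>The product of \<open>a + b \<zeta> + c \<zeta>\<^sup>2\<close> and \<open>a + b \<zeta>\<^sup>2 + c \<zeta>\<close> for a primitive cube root of unity
  \<open>\<zeta>\<close>, so a nondegenerate triangle makes it vanish iff it is equilateral.\<close>

definition equilateral_form :: "complex \<Rightarrow> complex \<Rightarrow> complex \<Rightarrow> complex" where
  "equilateral_form a b c = a\<^sup>2 + b\<^sup>2 + c\<^sup>2 - a * b - b * c - c * a"

lemma equilateral_form_perm:
  "equilateral_form b c a = equilateral_form a b c"
  "equilateral_form a c b = equilateral_form a b c"
  by (simp_all add: equilateral_form_def algebra_simps)

lemma dist_eq_if_equilateral_form_zero: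
  assumes "equilateral_form a b c = 0"
  shows "dist a b = dist c a"
proof -
  \<comment> \<open>With \<open>u = b - a\<close> and \<open>v = c - a\<close> the form is \<open>u\<^sup>2 - u v + v\<^sup>2\<close>, a divisor of \<open>u\<^sup>3 + v\<^sup>3\<close>.\<close>
  have "(b - a) ^ 3 = - ((c - a) ^ 3)"
    using assms unfolding equilateral_form_def by algebra
  then have "norm (b - a) ^ 3 = norm (c - a) ^ 3" by (metis norm_minus_cancel norm_power)
  then show ?thesis by (simp add: dist_norm norm_minus_commute power_eq_iff_eq_base)
qed

text \<open>The polar of the symmedian point. After division by \<open>a b c\<close> both sides are real for unimodular
  \<open>a, b, c\<close>, so this is a single real-linear equation for \<open>n\<close>. The factor \<open>(a b c)\<^sup>2\<close> makes
  the coefficient of \<open>cnj n\<close> a polynomial in \<open>a, b, c\<close>, see \<open>cnj_equilateral_form\<close>.\<close>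

definition on_lemoine_axis :: "complex \<Rightarrow> complex \<Rightarrow> complex \<Rightarrow> complex \<Rightarrow> bool" where
  "on_lemoine_axis a b c n \<longleftrightarrow>
     n * equilateral_form a b c + cnj n * (a * b * c)\<^sup>2 * cnj (equilateral_form a b c) =
     (a + b + c) * (a * b + b * c + c * a) - 9 * a * b * c"

lemma cnj_equilateral_form:
  assumes "norm a = 1" "norm b = 1" "norm c = 1"
  shows "(a * b * c)\<^sup>2 * cnj (equilateral_form a b c) =
     (a * b + b * c + c * a)\<^sup>2 - 3 * a * b * c * (a + b + c)"
proof -
  have nz: "a \<noteq> 0" "b \<noteq> 0" "c \<noteq> 0" and cn: "cnj a = 1 / a" "cnj b = 1 / b" "cnj c = 1 / c"
    using assms by (auto intro: cnj_unit)
  show ?thesis using nz by (simp add: equilateral_form_def cn field_simps power2_eq_square)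
qed

lemma on_lemoine_axis_cyclic: "on_lemoine_axis b c a n \<longleftrightarrow> on_lemoine_axis a b c n"
  by (simp add: on_lemoine_axis_def equilateral_form_perm
      mult.commute mult.left_commute add.commute add.left_commute)

lemma on_lemoine_axis_swap: "on_lemoine_axis a c b n \<longleftrightarrow> on_lemoine_axis a b c n"
  by (simp add: on_lemoine_axis_def equilateral_form_perm
      mult.commute mult.left_commute add.commute add.left_commute)

text \<open>The symmedian point lies inside the circle, so its polar misses the circle. At a vertex this is
  visible as a factorisation: the equation of the axis at \<open>b\<close> becomes \<open>((b - a) (b - c))\<^sup>2 = 0\<close>. It
  makes the axis of an isosceles triangle different from the base to which it is parallel.\<close>

lemma vertex_not_on_lemoine_axis:
  assumes "norm a = 1" "norm b = 1" "norm c = 1" "a \<noteq> b" "b \<noteq> c"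
  shows "\<not> on_lemoine_axis a b c b"
proof
  assume "on_lemoine_axis a b c b"
  then have e: "b * equilateral_form a b c + 1 / b * ((a * b + b * c + c * a)\<^sup>2 - 3 * a * b * c * (a + b + c)) =
     (a + b + c) * (a * b + b * c + c * a) - 9 * a * b * c"
    unfolding on_lemoine_axis_def mult.assoc cnj_equilateral_form[OF assms(1-3), unfolded mult.assoc]
    by (simp add: cnj_unit[OF assms(2)])
  have "b * b * equilateral_form a b c + ((a * b + b * c + c * a)\<^sup>2 - 3 * a * b * c * (a + b + c)) =
     b * ((a + b + c) * (a * b + b * c + c * a) - 9 * a * b * c)"
    unfolding e[symmetric] using assms(2) by (auto simp: distrib_left)
  then have "((b - a) * (b - c))\<^sup>2 = 0" unfolding equilateral_form_def by algebra
  then show False using assms by simp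
qed

lemma isosceles_unit_iff:
  fixes a b c :: complex
  assumes "norm a = 1" "norm b = 1" "norm c = 1" "b \<noteq> c"
  shows "dist a b = dist a c \<longleftrightarrow> a\<^sup>2 = b * c"
proof -
  have nz: "a \<noteq> 0" "b \<noteq> 0" "c \<noteq> 0" and cn: "cnj a = 1 / a" "cnj b = 1 / b" "cnj c = 1 / c"
    using assms(1-3) by (auto intro: cnj_unit)
  have "dist a b = dist a c \<longleftrightarrow> (norm (a - b))\<^sup>2 = (norm (a - c))\<^sup>2"
    by (simp add: dist_norm)
  also have "\<dots> \<longleftrightarrow> (a - b) * cnj (a - b) = (a - c) * cnj (a - c)"
    by (metis complex_norm_square of_real_eq_iff)
  also have "\<dots> \<longleftrightarrow> (c - b) * (a\<^sup>2 - b * c) = 0"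
    using nz by (simp add: cn field_simps power2_eq_square) algebra
  finally show ?thesis using assms(4) by auto
qed

lemma Re_eq_0_if_cnj: "cnj z = - z \<Longrightarrow> Re z = 0"
  by (simp add: complex_eq_iff)

text \<open>The axis is perpendicular to the conjugate of \<open>equilateral_form a b c / (a b c)\<close>; for an isosceles
  triangle with apex \<open>a\<close> this vector is perpendicular to the base as well.\<close>

lemma isosceles_axis_direction:
  fixes a b c :: complex
  assumes "norm a = 1" "norm b = 1" "norm c = 1" "a\<^sup>2 = b * c"
  shows "Re ((b - c) * (equilateral_form a b c / (a * b * c))) = 0"
proof -
  have nz: "a \<noteq> 0" "b \<noteq> 0" "c \<noteq> 0" and cn: "cnj a = 1 / a" "cnj b = 1 / b" "cnj c = 1 / c"
    using assms(1-3) by (auto intro: cnj_unit)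
  let ?z = "(b - c) * (equilateral_form a b c / (a * b * c))"
  have k: "b * c * equilateral_form a b c = (a * b * c)\<^sup>2 * cnj (equilateral_form a b c)"
    unfolding cnj_equilateral_form[OF assms(1-3)] using assms(4) unfolding equilateral_form_def by algebra
  have "cnj ?z = (c - b) / (b * c) * ((a * b * c)\<^sup>2 * cnj (equilateral_form a b c)) / (a * b * c)"
    using nz by (simp add: cn field_simps power2_eq_square)
  also have "\<dots> = - ?z" unfolding k[symmetric] using nz by (simp add: field_simps)
  finally show ?thesis by (rule Re_eq_0_if_cnj)
qed

section \<open>The inverse points as solutions of the equation of the axis\<close>

text \<open>The similarity to \<open>ACB\<close> gives a linear equation for \<open>cnj m\<close>, with the solution
  \<open>(a\<^sup>2 - b c) / (a (a b + a c - 2 b c))\<close>. The inverse \<open>n = 1 / cnj m\<close> is the point where the tangent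
  \<open>n + a\<^sup>2 cnj n = 2 a\<close> meets the chord \<open>n + b c cnj n = b + c\<close>, hence the simple value of \<open>cnj n\<close>.\<close>

lemma reversed_pedal_point:
  assumes u: "norm a = 1" "norm b = 1" "norm c = 1" "a \<noteq> b" "b \<noteq> c" "c \<noteq> a"
    and sh: "(c - a) * (1 - b * cnj m) / ((b - a) * (1 - c * cnj m)) = cnj ((b - a) / (c - a))"
    and nz1: "1 - c * cnj m \<noteq> 0"
  shows "m = 0 \<longleftrightarrow> a\<^sup>2 = b * c"
    and "m \<noteq> 0 \<Longrightarrow> on_lemoine_axis a b c (1 / cnj m)"
proof -
  have nz: "a \<noteq> 0" "b \<noteq> 0" "c \<noteq> 0" and cn: "cnj a = 1 / a" "cnj b = 1 / b" "cnj c = 1 / c"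
    using u(1-3) by (auto intro: cnj_unit)
  have "cnj ((b - a) / (c - a)) = c * (b - a) / (b * (c - a))"
    using nz u by (simp add: cn divide_simps) (simp add: algebra_simps)
  then have "(c - a) * (1 - b * cnj m) / ((b - a) * (1 - c * cnj m)) = c * (b - a) / (b * (c - a))"
    using sh by (rule trans[rotated])
  then have "(c - a) * (1 - b * cnj m) * (b * (c - a)) = c * (b - a) * ((b - a) * (1 - c * cnj m))"
    using nz1 nz u by (subst (asm) frac_eq_eq) auto
  then have "(c - b) * (cnj m * (a * (a * b + a * c - 2 * b * c)) - (a\<^sup>2 - b * c)) = 0"
    by algebra
  then have eq: "cnj m * (a * (a * b + a * c - 2 * b * c)) = a\<^sup>2 - b * c" using u by simp
  \<comment> \<open>If the denominator vanished, its conjugate would make \<open>a\<close> the midpoint of the chord \<open>bc\<close>.\<close>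
  have den: "a * b + a * c - 2 * b * c \<noteq> 0"
  proof
    assume "a * b + a * c - 2 * b * c = 0"
    then have "cnj (a * b + a * c - 2 * b * c) * (a * b * c) = 0" by simp
    then have "(a * b\<^sup>2 * c\<^sup>2) * (b + c - 2 * a) = 0"
      using nz by (simp add: cn field_simps) algebra
    then have "b + c = 2 * a" using nz by simp
    moreover have "a * (b + c) = 2 * b * c" using \<open>a * b + a * c - 2 * b * c = 0\<close> by algebra
    ultimately have "(b - c)\<^sup>2 = 0" by algebra
    then show False using u by simp
  qed
  show iff: "m = 0 \<longleftrightarrow> a\<^sup>2 = b * c"
    using eq den nz by auto
  assume m: "m \<noteq> 0"
  define n where "n = 1 / cnj m"
  have k: "a\<^sup>2 - b * c \<noteq> 0" using iff m by simp
  have n1: "n * (a\<^sup>2 - b * c) = a * (a * b + a * c - 2 * b * c)"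
    unfolding n_def eq[symmetric] using m by simp
  have "cnj (n * (a\<^sup>2 - b * c)) = cnj (a * (a * b + a * c - 2 * b * c))" using n1 by simp
  then have n2: "cnj n * (a\<^sup>2 - b * c) = 2 * a - b - c"
    using nz by (simp add: cn field_simps power2_eq_square) algebra
  have "(a\<^sup>2 - b * c) * (n * equilateral_form a b c + cnj n * ((a * b + b * c + c * a)\<^sup>2 - 3 * a * b * c * (a + b + c)))
     = (a\<^sup>2 - b * c) * ((a + b + c) * (a * b + b * c + c * a) - 9 * a * b * c)"
    using n1 n2 unfolding equilateral_form_def by algebra
  then show "on_lemoine_axis a b c (1 / cnj m)"
    unfolding on_lemoine_axis_def mult.assoc cnj_equilateral_form[OF u(1-3), unfolded mult.assoc]
    using k by (simp add: n_def mult.assoc)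
qed

text \<open>By the converse of the tangent-chord theorem, the assumption says that \<open>w\<close> lies on the circle
  through \<open>a\<close> and \<open>b\<close> that touches the line \<open>bc\<close> at \<open>b\<close>. Its equation arises by eliminating the real
  factor \<open>t\<close> between the assumption and its conjugate.\<close>

lemma tangent_circle_equation:
  assumes u: "norm a = 1" "norm b = 1" "norm c = 1" "a \<noteq> b" "b \<noteq> c"
    and w: "(w - a) / (b - a) = of_real t * ((w - b) / (c - b))"
  shows "b * (c - a) * (w * cnj w) + (b - c) * w + a * b * (b - c) * cnj w + a * c - b\<^sup>2 = 0"
proof -
  have nz: "a \<noteq> 0" "b \<noteq> 0" "c \<noteq> 0" and cn: "cnj a = 1 / a" "cnj b = 1 / b" "cnj c = 1 / c"
    using u(1-3) by (auto intro: cnj_unit)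
  have e: "(w - a) * (c - b) = of_real t * (w - b) * (b - a)"
    using w u by (simp add: field_simps)
  have "cnj ((w - a) * (c - b)) = cnj (of_real t * (w - b) * (b - a))" using e by simp
  then have e': "(a * cnj w - 1) * (b - c) * b = of_real t * (b * cnj w - 1) * (a - b) * c"
    using nz by (simp add: cn field_simps) algebra
  have "((b - c) * (a - b)) * ((w - a) * (b * cnj w - 1) * c - (a * cnj w - 1) * (w - b) * b) = 0"
    using e e' by algebra
  then have "(w - a) * (b * cnj w - 1) * c - (a * cnj w - 1) * (w - b) * b = 0" using u by simp
  then show ?thesis by algebra
qed

text \<open>The Brocard point is on three tangent circles. The coefficients of \<open>w cnj w\<close> and of \<open>w\<close> cancel in
  the sum of their equations, which leaves \<open>cnj w\<close> as an explicit quotient. This also shows that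
  \<open>w\<close> differs from the centre, and gives the shape of its pedal triangle, that of \<open>bca\<close>.\<close>

lemma brocard_point:
  assumes u: "norm a = 1" "norm b = 1" "norm c = 1" "a \<noteq> b" "b \<noteq> c" "c \<noteq> a"
    and D: "equilateral_form a b c \<noteq> 0"
    and w1: "(w - a) / (b - a) = of_real s * ((w - b) / (c - b))"
    and w2: "(w - b) / (c - b) = of_real t * ((w - c) / (a - c))"
    and w3: "(w - c) / (a - c) = of_real r * ((w - a) / (b - a))"
  shows "w \<noteq> 0" "1 - c * cnj w \<noteq> 0"
    "(c - a) * (1 - b * cnj w) / ((b - a) * (1 - c * cnj w)) = (a - b) / (c - b)"
    "on_lemoine_axis a b c (1 / cnj w)"
proof -
  have nz: "a \<noteq> 0" "b \<noteq> 0" "c \<noteq> 0" and cn: "cnj a = 1 / a" "cnj b = 1 / b" "cnj c = 1 / c"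
    using u(1-3) by (auto intro: cnj_unit)
  let ?N = "a * b\<^sup>2 + b * c\<^sup>2 + c * a\<^sup>2 - 3 * a * b * c"
  have c1: "b * (c - a) * (w * cnj w) + (b - c) * w + a * b * (b - c) * cnj w + a * c - b\<^sup>2 = 0"
    using tangent_circle_equation[OF _ _ _ _ _ w1] u by simp
  have c2: "c * (a - b) * (w * cnj w) + (c - a) * w + b * c * (c - a) * cnj w + b * a - c\<^sup>2 = 0"
    using tangent_circle_equation[OF _ _ _ _ _ w2] u by simp
  have c3: "a * (b - c) * (w * cnj w) + (a - b) * w + c * a * (a - b) * cnj w + c * b - a\<^sup>2 = 0"
    using tangent_circle_equation[OF _ _ _ _ _ w3] u by simp
  have e: "cnj w * ?N = equilateral_form a b c"
    using c1 c2 c3 unfolding equilateral_form_def by algebra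
  show w0: "w \<noteq> 0" using e D by auto
  have N0: "?N \<noteq> 0" using e D by auto
  have fc: "?N * (1 - c * cnj w) = (b - c)\<^sup>2 * (a - c)"
    using e unfolding equilateral_form_def by algebra
  have fb: "?N * (1 - b * cnj w) = (a - b)\<^sup>2 * (c - b)"
    using e unfolding equilateral_form_def by algebra
  show nz1: "1 - c * cnj w \<noteq> 0" using fc u N0 by auto
  have "?N * ((c - a) * (1 - b * cnj w) * (c - b)) = ?N * ((a - b) * ((b - a) * (1 - c * cnj w)))"
    using fb fc by algebra
  then have "(c - a) * (1 - b * cnj w) * (c - b) = (a - b) * ((b - a) * (1 - c * cnj w))"
    using N0 by (simp only: mult_cancel_left) simp
  then show "(c - a) * (1 - b * cnj w) / ((b - a) * (1 - c * cnj w)) = (a - b) / (c - b)"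
    using nz1 u by (subst frac_eq_eq) auto
  have n1: "1 / cnj w * equilateral_form a b c = ?N"
    unfolding e[symmetric] using w0 by simp
  have "1 / w * cnj (equilateral_form a b c) = cnj ?N"
    using arg_cong[OF n1, of cnj] by simp
  then have "1 / w * (a * b * c)\<^sup>2 * cnj (equilateral_form a b c) = (a * b * c)\<^sup>2 * cnj ?N"
    by (metis mult.assoc mult.commute)
  also have "\<dots> = a\<^sup>2 * b + b\<^sup>2 * c + c\<^sup>2 * a - 3 * a * b * c"
    using nz by (simp add: cn field_simps power2_eq_square)
  finally have n2: "1 / w * (a * b * c)\<^sup>2 * cnj (equilateral_form a b c) = \<dots>" .
  show "on_lemoine_axis a b c (1 / cnj w)"
    unfolding on_lemoine_axis_def n1 complex_cnj_divide complex_cnj_cnj complex_cnj_one n2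
    by algebra
qed

section \<open>Lines as level sets of linear functionals\<close>

lemma affine_hull_eq_level_set:
  fixes g P Q :: complex
  assumes "g \<noteq> 0" "P \<noteq> Q" "g \<bullet> P = k" "g \<bullet> Q = k"
  shows "affine hull {P, Q} = {X. g \<bullet> X = k}"
proof
  show "affine hull {P, Q} \<subseteq> {X. g \<bullet> X = k}"
    using assms by (auto simp: affine_hull_2_alt inner_add_right inner_diff_right inner_scaleR_right)
  show "{X. g \<bullet> X = k} \<subseteq> affine hull {P, Q}"
  proof
    fix X assume X: "X \<in> {X. g \<bullet> X = k}"
    have "g \<bullet> (X - P) = 0" "g \<bullet> (Q - P) = 0"
      using X assms by (simp_all add: inner_diff_right)
    then have "Re (cnj g * (X - P)) = 0" "Re (cnj g * (Q - P)) = 0"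
      unfolding inner_eq_Re_cnj_mult by simp_all
    moreover have "Im (p / q) = 0" if "Re p = 0" "Re q = 0" for p q
      using that by (simp add: Im_divide)
    ultimately have "Im ((cnj g * (X - P)) / (cnj g * (Q - P))) = 0" by blast
    then have "Im ((X - P) / (Q - P)) = 0" using assms(1) by simp
    then have "(X - P) / (Q - P) = of_real (Re ((X - P) / (Q - P)))" by (simp add: complex_eq_iff)
    then have "X = P + Re ((X - P) / (Q - P)) *\<^sub>R (Q - P)"
      using assms(2)
      by (metis add_diff_cancel_left' diff_add_cancel eq_iff_diff_eq_0 nonzero_eq_divide_eq
        scaleR_conv_of_real add.commute)
    then show "X \<in> affine hull {P, Q}" unfolding affine_hull_2_alt by blast
  qed
qed

lemma is_line_level_set:
  fixes g :: complex
  assumes "g \<noteq> 0"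
  shows "is_line {X. g \<bullet> X = k}"
proof -
  define P where "P = (k / (g \<bullet> g)) *\<^sub>R g"
  have "g \<bullet> P = k" using assms by (simp add: P_def)
  moreover have "g \<bullet> (P + \<i> * g) = k"
    using calculation by (simp add: inner_add_right) (simp add: inner_complex_def)
  moreover have "P \<noteq> P + \<i> * g" using assms by simp
  ultimately show ?thesis unfolding is_line_def
    using affine_hull_eq_level_set[OF assms, of P "P + \<i> * g" k] by metis
qed

lemma parallel_level_set:
  fixes g P Q :: complex
  assumes "P \<noteq> Q" "g \<bullet> P = g \<bullet> Q" "g \<bullet> P \<noteq> k" "g \<noteq> 0"
  shows "parallel_lines {X. g \<bullet> X = k} (affine hull {P, Q})"
proof -
  have h: "affine hull {P, Q} = {X. g \<bullet> X = g \<bullet> P}"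
    using affine_hull_eq_level_set assms by auto
  define v where "v = ((g \<bullet> P - k) / (g \<bullet> g)) *\<^sub>R g"
  have v: "g \<bullet> v = g \<bullet> P - k" using assms(4) by (simp add: v_def)
  have "{X. g \<bullet> X = g \<bullet> P} = (\<lambda>X. v + X) ` {X. g \<bullet> X = k}"
  proof (intro set_eqI iffI)
    fix X assume "X \<in> {X. g \<bullet> X = g \<bullet> P}"
    then have "X - v \<in> {X. g \<bullet> X = k}" "X = v + (X - v)" using v by (simp_all add: inner_diff_right)
    then show "X \<in> (\<lambda>X. v + X) ` {X. g \<bullet> X = k}" by blast
  qed (use v in \<open>auto simp: inner_add_right\<close>)
  then have "affine_parallel {X. g \<bullet> X = k} (affine hull {P, Q})"
    unfolding h affine_parallel_def by blast
  moreover have "P \<in> affine hull {P, Q}" by (simp add: hull_inc)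
  then have "{X. g \<bullet> X = k} \<noteq> affine hull {P, Q}" using assms(3) by blast
  ultimately show ?thesis using is_line_level_set[OF assms(4)] assms(1)
    unfolding parallel_lines_def by (metis is_line_def)
qed

section \<open>The Lemoine axis in the plane of the triangle\<close>

definition lemoine_axis :: "complex \<Rightarrow> real \<Rightarrow> complex \<Rightarrow> complex \<Rightarrow> complex \<Rightarrow> complex set" where
  "lemoine_axis Z R a b c = {Z + of_real R * n | n. on_lemoine_axis a b c n}"

lemma lemoine_axis_cyclic: "lemoine_axis Z R b c a = lemoine_axis Z R a b c"
  by (simp add: lemoine_axis_def on_lemoine_axis_cyclic)

lemma lemoine_axis_swap: "lemoine_axis Z R a c b = lemoine_axis Z R a b c"
  by (simp add: lemoine_axis_def on_lemoine_axis_swap)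

text \<open>Dividing the equation by \<open>a b c\<close> turns its left side into a number plus its conjugate, and its
  right side into \<open>\<bar>a + b + c\<bar>\<^sup>2 - 9\<close>, since \<open>a b + b c + c a = a b c cnj (a + b + c)\<close>.\<close>

lemma on_lemoine_axis_iff_Re:
  assumes "norm a = 1" "norm b = 1" "norm c = 1"
  shows "on_lemoine_axis a b c n \<longleftrightarrow>
    Re (n * (equilateral_form a b c / (a * b * c))) = ((norm (a + b + c))\<^sup>2 - 9) / 2"
proof -
  have nz: "a \<noteq> 0" "b \<noteq> 0" "c \<noteq> 0" and cn: "cnj a = 1 / a" "cnj b = 1 / b" "cnj c = 1 / c"
    using assms by (auto intro: cnj_unit)
  let ?E = "equilateral_form a b c" and ?p = "a * b * c"
  let ?z = "n * (?E / ?p)"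
  have p: "?p \<noteq> 0" using nz by simp
  have z: "?p * (?z + cnj ?z) = n * ?E + cnj n * ?p\<^sup>2 * cnj ?E"
    using nz by (simp add: cn field_simps power2_eq_square)
  have s: "?p * of_real ((norm (a + b + c))\<^sup>2 - 9) = (a + b + c) * (a * b + b * c + c * a) - 9 * a * b * c"
    using nz by (simp add: complex_norm_square cn field_simps del: of_real_power)
  have "on_lemoine_axis a b c n \<longleftrightarrow> ?z + cnj ?z = of_real ((norm (a + b + c))\<^sup>2 - 9)"
    unfolding on_lemoine_axis_def z[symmetric] s[symmetric] using p by (simp only: mult_cancel_left) simp
  also have "?z + cnj ?z = of_real (2 * Re ?z)" by (rule complex_add_cnj)
  finally show ?thesis unfolding of_real_eq_iff by auto
qed

lemma Re_of_real_mult: "Re (of_real x * z) = x * Re z"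
  by simp

lemma lemoine_axis_level_set:
  assumes "norm a = 1" "norm b = 1" "norm c = 1" "equilateral_form a b c \<noteq> 0" "R > 0"
  obtains g k where "g = cnj (equilateral_form a b c / (a * b * c))" "g \<noteq> 0"
    "lemoine_axis Z R a b c = {X. g \<bullet> X = k}"
proof
  let ?g = "cnj (equilateral_form a b c / (a * b * c))"
  let ?h = "((norm (a + b + c))\<^sup>2 - 9) / 2"
  show "?g = ?g" ..
  show "?g \<noteq> 0" using assms by auto
  have i: "?g \<bullet> (Z + of_real R * n) = ?g \<bullet> Z + R * Re (n * (equilateral_form a b c / (a * b * c)))" for n
  proof -
    have "cnj ?g * (of_real R * n) = of_real R * (n * (equilateral_form a b c / (a * b * c)))" by simp
    then have "?g \<bullet> (of_real R * n) = R * Re (n * (equilateral_form a b c / (a * b * c)))"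
      unfolding inner_eq_Re_cnj_mult by (metis Re_of_real_mult)
    then show ?thesis by (simp only: inner_add_right)
  qed
  show "lemoine_axis Z R a b c = {X. ?g \<bullet> X = ?g \<bullet> Z + R * ?h}"
  proof (intro set_eqI)
    fix X
    have X: "X = Z + of_real R * n \<longleftrightarrow> n = (X - Z) / of_real R" for n
      using assms(5) by (auto simp: field_simps)
    have "X \<in> lemoine_axis Z R a b c \<longleftrightarrow> on_lemoine_axis a b c ((X - Z) / of_real R)"
      unfolding lemoine_axis_def mem_Collect_eq X by blast
    also have "\<dots> \<longleftrightarrow> R * Re ((X - Z) / of_real R * (equilateral_form a b c / (a * b * c))) = R * ?h"
      unfolding on_lemoine_axis_iff_Re[OF assms(1-3)] using assms(5) by (simp only: mult_cancel_left) simp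
    also have "\<dots> \<longleftrightarrow> ?g \<bullet> X = ?g \<bullet> Z + R * ?h"
      using i[of "(X - Z) / of_real R"] assms(5) by (simp del: complex_cnj_divide)
    finally show "X \<in> lemoine_axis Z R a b c \<longleftrightarrow> X \<in> {X. ?g \<bullet> X = ?g \<bullet> Z + R * ?h}" by simp
  qed
qed

lemma is_line_lemoine_axis:
  assumes "norm a = 1" "norm b = 1" "norm c = 1" "equilateral_form a b c \<noteq> 0" "R > 0"
  shows "is_line (lemoine_axis Z R a b c)"
  by (metis lemoine_axis_level_set[OF assms] is_line_level_set)

lemma lemoine_axis_parallel_base:
  assumes u: "norm a = 1" "norm b = 1" "norm c = 1" "a \<noteq> b" "b \<noteq> c" "c \<noteq> a"
    and E: "equilateral_form a b c \<noteq> 0" and R: "R > 0"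
    and X: "A = Z + of_real R * a" "B = Z + of_real R * b" "C = Z + of_real R * c"
    and iso: "dist A B = dist A C"
  shows "parallel_lines (lemoine_axis Z R a b c) (affine hull {B, C})"
proof -
  obtain g k where g: "g = cnj (equilateral_form a b c / (a * b * c))" "g \<noteq> 0"
    "lemoine_axis Z R a b c = {X. g \<bullet> X = k}"
    using lemoine_axis_level_set[OF u(1-3) E R] by blast
  have BC: "B \<noteq> C" using u R X by simp
  have "dist a b = dist a c"
    using iso R unfolding X dist_norm by (simp add: right_diff_distrib[symmetric] norm_mult)
  then have sq: "a\<^sup>2 = b * c" using isosceles_unit_iff u by blast
  have "g \<bullet> (B - C) = R * Re ((b - c) * (equilateral_form a b c / (a * b * c)))"
  proof -
    have "cnj g * (B - C) = of_real R * ((b - c) * (equilateral_form a b c / (a * b * c)))"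
      unfolding g(1) X by (simp add: algebra_simps diff_divide_distrib)
    then show ?thesis unfolding inner_eq_Re_cnj_mult by (metis Re_of_real_mult)
  qed
  then have "g \<bullet> B = g \<bullet> C"
    using isosceles_axis_direction[OF u(1-3) sq] by (simp add: inner_diff_right)
  moreover have "B \<notin> lemoine_axis Z R a b c"
    using vertex_not_on_lemoine_axis[OF u(1-5)] R by (auto simp: lemoine_axis_def X)
  ultimately show ?thesis using parallel_level_set[OF BC, of g k] g by auto
qed

section \<open>Brocard points, reversed pedal triangles and inversion\<close>

text \<open>The signed areas of \<open>ABW\<close> and \<open>ABC\<close> have the barycentric coordinate of \<open>W\<close> at \<open>C\<close> as their
  quotient, and it is positive inside the triangle. For a
  Brocard point this makes the three equal angles equal as directed angles.\<close>

lemma interior_triangle_orientation: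
  assumes "\<not> collinear {A, B, C}" "W \<in> interior (convex hull {A, B, C})"
  shows "orientation A B W = orientation A B C"
proof -
  obtain x y z where xyz: "0 < z" "x + y + z = 1" "W = x *\<^sub>R A + y *\<^sub>R B + z *\<^sub>R C"
    using assms interior_convex_hull_3_minimal[OF assms(1)] by auto
  have x: "x = 1 - y - z" using xyz(2) by simp
  have W: "W - A = of_real y * (B - A) + of_real z * (C - A)"
    unfolding xyz(3) x by (simp add: scaleR_conv_of_real algebra_simps)
  have "Im (cnj u * (of_real y * u + of_real z * v)) = z * Im (cnj u * v)" for u v
    by (simp add: algebra_simps)
  then have "Im (cnj (B - A) * (W - A)) = z * Im (cnj (B - A) * (C - A))" unfolding W .
  then show ?thesis unfolding orientation_def using xyz(1) by (simp add: sgn_mult)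
qed

lemma first_brocard_shapes:
  assumes "\<not> collinear {A, B, C}" "first_brocard A B C W"
  obtains s t r where "shape A B W = of_real s * shape B C W" "shape B C W = of_real t * shape C A W"
    "shape C A W = of_real r * shape A B W"
proof -
  have int: "W \<in> interior (convex hull {A, B, C})"
    and ang: "angle B A W = angle C B W" "angle C B W = angle A C W"
    using assms(2) by (auto simp: first_brocard_def angle_commute)
  have o: "orientation A B W = orientation A B C" "orientation B C W = orientation A B C"
    "orientation C A W = orientation A B C"
    using interior_triangle_orientation[of A B C W] interior_triangle_orientation[of B C A W]
      interior_triangle_orientation[of C A B W] int assms(1)
    by (simp_all add: insert_commute orientation_cyclic)
  have nz: "orientation A B C \<noteq> 0" using assms(1) by (simp add: collinear_iff_orientation)
  have sg: "sgn (Im (shape A B W)) = orientation A B C" "sgn (Im (shape B C W)) = orientation A B C"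
    "sgn (Im (shape C A W)) = orientation A B C"
    using o by (simp_all add: orientation_eq_sgn_Im_shape)
  have im: "Im (shape A B W) \<noteq> 0" "Im (shape B C W) \<noteq> 0" "Im (shape C A W) \<noteq> 0"
    using sg nz by (metis sgn_zero)+
  note ang' = ang[unfolded angle_eq_unsigned_arg_shape]
  obtain s where s: "shape A B W = of_real s * shape B C W"
    using same_direction[OF ang'(1)] sg im by metis
  obtain t where t: "shape B C W = of_real t * shape C A W"
    using same_direction[OF ang'(2)] sg im by metis
  obtain r where r: "shape C A W = of_real r * shape A B W"
    using same_direction[OF trans[OF ang'(1) ang'(2), symmetric]] sg im by metis
  show thesis using that s t r .
qed

lemma first_brocard_pedal_and_inverse:
  assumes u: "norm a = 1" "norm b = 1" "norm c = 1"
    and E: "equilateral_form a b c \<noteq> 0" and R: "R > 0"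
    and X: "A = Z + of_real R * a" "B = Z + of_real R * b" "C = Z + of_real R * c"
    and nc: "\<not> collinear {A, B, C}" and W: "first_brocard A B C W"
  shows "W \<noteq> Z" "inverse_point Z R W \<in> lemoine_axis Z R a b c"
    "pedal_positive A B C W" "pedal_similar A B C W B C A"
proof -
  have d: "a \<noteq> b" "b \<noteq> c" "c \<noteq> a" using noncollinear_distinct[OF nc] X by auto
  define w where "w = (W - Z) / of_real R"
  have w: "W = Z + of_real R * w" using R by (simp add: w_def)
  have sh: "shape (Z + of_real R * p) (Z + of_real R * q) (Z + of_real R * r) = (r - p) / (q - p)" for p q r
    using R by (simp add: shape_def right_diff_distrib[symmetric])
  obtain s t r where str: "(w - a) / (b - a) = of_real s * ((w - b) / (c - b))"
    "(w - b) / (c - b) = of_real t * ((w - c) / (a - c))"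
    "(w - c) / (a - c) = of_real r * ((w - a) / (b - a))"
    using first_brocard_shapes[OF nc W] unfolding X w sh by metis
  note bp = brocard_point[OF u d E str]
  show "W \<noteq> Z" using bp(1) R w by simp
  show "inverse_point Z R W \<in> lemoine_axis Z R a b c"
    unfolding w inverse_point_normalised[OF R bp(1)] lemoine_axis_def using bp(4) by blast
  have ps: "shape (foot W B C) (foot W C A) (foot W A B) = shape B C A"
    unfolding pedal_shape[OF u d less_imp_neq[OF R, symmetric] X w] bp(3) unfolding X sh ..
  show "pedal_positive A B C W"
    unfolding pedal_positive_def orientation_eq_sgn_Im_shape ps
    by (simp add: orientation_eq_sgn_Im_shape[symmetric] orientation_cyclic)
  show "pedal_similar A B C W B C A"
    unfolding pedal_similar_def using shape_eq_imp_similar[OF _ ps] nc by (simp add: insert_commute)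
qed

lemma reversed_pedal_inverse:
  assumes u: "norm a = 1" "norm b = 1" "norm c = 1" and R: "R > 0"
    and X: "A = Z + of_real R * a" "B = Z + of_real R * b" "C = Z + of_real R * c"
    and nc: "\<not> collinear {A, B, C}" and L: "pedal_positive A B C L" "pedal_similar A B C L A C B"
  shows "L = Z \<longleftrightarrow> dist A B = dist A C"
    "L \<noteq> Z \<Longrightarrow> inverse_point Z R L \<in> lemoine_axis Z R a b c"
proof -
  have d: "a \<noteq> b" "b \<noteq> c" "c \<noteq> a" using noncollinear_distinct[OF nc] X by auto
  define m where "m = (L - Z) / of_real R"
  have m: "L = Z + of_real R * m" using R by (simp add: m_def)
  have "shape (foot L B C) (foot L C A) (foot L A B) = cnj (shape A C B)"
    using L similar_imp_shape_eq_cnj unfolding pedal_positive_def pedal_similar_def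
    by (metis orientation_swap minus_minus)
  moreover have "shape A C B = (b - a) / (c - a)"
    using R unfolding X by (simp add: shape_def right_diff_distrib[symmetric])
  ultimately have sh: "(c - a) * (1 - b * cnj m) / ((b - a) * (1 - c * cnj m)) = cnj ((b - a) / (c - a))"
    using pedal_shape[OF u d less_imp_neq[OF R, symmetric] X m] by simp
  then have nz: "1 - c * cnj m \<noteq> 0" using d by auto
  note rp = reversed_pedal_point[OF u d sh nz]
  have "dist A B = dist A C \<longleftrightarrow> dist a b = dist a c"
    using R unfolding X dist_norm by (simp add: right_diff_distrib[symmetric] norm_mult)
  then show "L = Z \<longleftrightarrow> dist A B = dist A C"
    using rp(1) isosceles_unit_iff[OF u d(2)] m R by simp
  assume "L \<noteq> Z"
  then have m0: "m \<noteq> 0" using m by auto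
  then show "inverse_point Z R L \<in> lemoine_axis Z R a b c"
    unfolding m inverse_point_normalised[OF R m0] lemoine_axis_def using rp(2) by blast
qed

text \<open>Put \<open>1 / cnj m\<close> into the formula for the shape of the pedal triangle: since \<open>cnj b = 1 / b\<close>, the
  factor \<open>1 - b / m\<close> is the conjugate of \<open>1 - b cnj m\<close> times \<open>- b / m\<close>. The extra factors, with those
  that come from \<open>c - a\<close> and \<open>b - a\<close>, cancel in the quotient, so that the shape is conjugated.\<close>

lemma pedal_triangle_inverse:
  assumes u: "norm a = 1" "norm b = 1" "norm c = 1" and R: "R > 0"
    and X: "A = Z + of_real R * a" "B = Z + of_real R * b" "C = Z + of_real R * c"
    and nc: "\<not> collinear {A, B, C}" and M: "M \<noteq> Z"
    and pos: "pedal_positive A B C M" and sim: "pedal_similar A B C M U V W"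
  shows "pedal_negative A B C (inverse_point Z R M)"
    "pedal_similar A B C (inverse_point Z R M) U V W"
proof -
  have d: "a \<noteq> b" "b \<noteq> c" "c \<noteq> a" using noncollinear_distinct[OF nc] X by auto
  have nz: "a \<noteq> 0" "b \<noteq> 0" "c \<noteq> 0" and cn: "cnj a = 1 / a" "cnj b = 1 / b" "cnj c = 1 / c"
    using u by (auto intro: cnj_unit)
  define m where "m = (M - Z) / of_real R"
  have m: "M = Z + of_real R * m" using R by (simp add: m_def)
  have m0: "m \<noteq> 0" using M m by auto
  let ?N = "inverse_point Z R M"
  have N: "?N = Z + of_real R * (1 / cnj m)" unfolding m by (rule inverse_point_normalised[OF R m0])
  note R0 = less_imp_neq[OF R, symmetric]
  let ?s = "shape (foot M B C) (foot M C A) (foot M A B)"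
  let ?s' = "shape (foot ?N B C) (foot ?N C A) (foot ?N A B)"
  have ncM: "\<not> collinear {foot M B C, foot M C A, foot M A B}"
    using sim by (simp add: pedal_similar_def similar_triangles_def)
  have s: "?s = (c - a) * (1 - b * cnj m) / ((b - a) * (1 - c * cnj m))"
    by (rule pedal_shape[OF u d R0 X m])
  have nz1: "1 - c * cnj m \<noteq> 0" using ncM by (auto simp: noncollinear_Im_shape s)
  have nz2: "m \<noteq> c" using nz1 nz by (auto simp: cn)
  have "?s' = (c - a) * (1 - b / m) / ((b - a) * (1 - c / m))"
    using pedal_shape[OF u d R0 X N] by simp
  also have "\<dots> = (c - a) * (m - b) / ((b - a) * (m - c))"
  proof -
    have "1 - b / m = (m - b) / m" "1 - c / m = (m - c) / m" using m0 by (simp_all add: diff_divide_distrib)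
    then show ?thesis using m0 by simp
  qed
  also have "\<dots> = cnj ?s"
  proof -
    have "1 - cnj c * m \<noteq> 0" using nz2 nz by (simp add: cn)
    then show ?thesis unfolding s
      using nz nz2 d by (simp add: cn divide_simps) algebra
  qed
  finally have s': "?s' = cnj ?s" .
  show "pedal_negative A B C ?N"
    using pos unfolding pedal_negative_def pedal_positive_def
    by (simp add: orientation_eq_sgn_Im_shape s' sgn_minus)
  show "pedal_similar A B C ?N U V W"
    using similar_trans[OF shape_eq_cnj_imp_similar[OF ncM s']] sim unfolding pedal_similar_def .
qed


section \<open>Renaming the vertices\<close>

lemma foot_commute: "foot M P Q = foot M Q P"
proof -
  have "orthogonal (M - F) (Q - P) = orthogonal (M - F) (P - Q)" for F
    by (auto simp: orthogonal_def inner_diff_right)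
  then show ?thesis by (simp add: foot_def insert_commute)
qed

lemma pedal_positive_cyclic: "pedal_positive A B C M \<Longrightarrow> pedal_positive B C A M"
  by (simp add: pedal_positive_def orientation_cyclic)

lemma pedal_similar_cyclic: "pedal_similar A B C M U V W \<Longrightarrow> pedal_similar B C A M V W U"
  unfolding pedal_similar_def by (rule similar_cyclic)

lemma pedal_positive_swap: "pedal_positive A C B M \<Longrightarrow> pedal_positive A B C M"
  unfolding pedal_positive_def
  by (metis foot_commute orientation_swap minus_minus)

lemma pedal_similar_swap: "pedal_similar A C B M U V W \<Longrightarrow> pedal_similar A B C M U W V"
  unfolding pedal_similar_def using similar_swap by (metis foot_commute)

lemma second_brocard_iff_first: "second_brocard A B C W \<longleftrightarrow> first_brocard A C B W"
  by (auto simp: second_brocard_def first_brocard_def insert_commute)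

theorem theorem2p2:
  fixes A B C Z \<Omega>1 \<Omega>2 L1 L2 L3 :: complex and R :: real
  assumes triangle: "\<not> collinear {A, B, C}"
    and not_equilateral: "\<not> (dist A B = dist B C \<and> dist B C = dist C A)"
    and circumcircle: "{A, B, C} \<subseteq> sphere Z R"
    and brocard1: "first_brocard A B C \<Omega>1"
    and brocard2: "second_brocard A B C \<Omega>2"
    and L1: "pedal_positive A B C L1" "pedal_similar A B C L1 A C B"
    and L2: "pedal_positive A B C L2" "pedal_similar A B C L2 C B A"
    and L3: "pedal_positive A B C L3" "pedal_similar A B C L3 B A C"
  shows "\<Omega>1 \<noteq> Z \<and> \<Omega>2 \<noteq> Z \<and>
    (L1 = Z \<longleftrightarrow> dist A B = dist A C) \<and>
    (L2 = Z \<longleftrightarrow> dist B C = dist B A) \<and>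
    (L3 = Z \<longleftrightarrow> dist C A = dist C B) \<and>
    (\<forall>M \<in> {\<Omega>1, \<Omega>2, L1, L2, L3} - {Z}.
       pedal_negative A B C (inverse_point Z R M) \<and>
       pedal_similar_some_order A B C (inverse_point Z R M)) \<and>
    (\<exists>l. is_line l \<and>
       (\<forall>M \<in> {\<Omega>1, \<Omega>2, L1, L2, L3} - {Z}. inverse_point Z R M \<in> l) \<and>
       (dist A B = dist A C \<longrightarrow> parallel_lines l (affine hull {B, C})) \<and>
       (dist B C = dist B A \<longrightarrow> parallel_lines l (affine hull {C, A})) \<and>
       (dist C A = dist C B \<longrightarrow> parallel_lines l (affine hull {A, B})))"
proof -
  have RA: "dist Z A = R" "dist Z B = R" "dist Z C = R" using circumcircle by auto
  have "R \<noteq> 0" using RA noncollinear_distinct[OF triangle] by auto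
  moreover have "R \<ge> 0" using RA(1) zero_le_dist by metis
  ultimately have R: "R > 0" by simp
  define a b c where "a = (A - Z) / of_real R" and "b = (B - Z) / of_real R" and "c = (C - Z) / of_real R"
  have X: "A = Z + of_real R * a" "B = Z + of_real R * b" "C = Z + of_real R * c"
    using R by (simp_all add: a_def b_def c_def)
  have u: "norm a = 1" "norm b = 1" "norm c = 1"
    using R RA by (simp_all add: a_def b_def c_def norm_divide dist_norm norm_minus_commute)
  have dist_scale: "dist (Z + of_real R * p) (Z + of_real R * q) = R * dist p q" for p q
    using R by (simp add: dist_norm right_diff_distrib[symmetric] norm_mult)
  have E: "equilateral_form a b c \<noteq> 0"
  proof
    assume "equilateral_form a b c = 0"
    then have "dist a b = dist c a" "dist b c = dist a b"
      using dist_eq_if_equilateral_form_zero[of a b c] dist_eq_if_equilateral_form_zero[of b c a]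
      by (simp_all only: equilateral_form_perm)
    then show False using not_equilateral unfolding X dist_scale by simp
  qed
  have d: "a \<noteq> b" "b \<noteq> c" "c \<noteq> a" using noncollinear_distinct[OF triangle] X by auto
  let ?l = "lemoine_axis Z R a b c"

  have tri: "\<not> collinear {B, C, A}" "\<not> collinear {C, A, B}" "\<not> collinear {A, C, B}"
    using triangle by (simp_all add: insert_commute)
  have ax: "lemoine_axis Z R b c a = ?l" "lemoine_axis Z R c a b = ?l" "lemoine_axis Z R a c b = ?l"
    by (simp_all add: lemoine_axis_cyclic lemoine_axis_swap)
  have E': "equilateral_form b c a \<noteq> 0" "equilateral_form c a b \<noteq> 0" "equilateral_form a c b \<noteq> 0"
    using E by (simp_all add: equilateral_form_perm)

  \<comment> \<open>\<open>\<Omega>2\<close> is the first Brocard point of \<open>ACB\<close>. The condition on \<open>L2\<close> is that on \<open>L1\<close> read in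
    \<open>BCA\<close>, and the one on \<open>L3\<close> is that on \<open>L1\<close> read in \<open>CAB\<close>.\<close>
  note O1 = first_brocard_pedal_and_inverse[OF u E R X triangle brocard1]
  note O2 = first_brocard_pedal_and_inverse[OF u(1,3,2) E'(3) R X(1,3,2) tri(3)
      brocard2[unfolded second_brocard_iff_first], unfolded ax]
  have O2': "pedal_positive A B C \<Omega>2" "pedal_similar A B C \<Omega>2 C A B"
    using O2(3,4) by (auto intro: pedal_positive_swap pedal_similar_swap)

  note P1 = reversed_pedal_inverse[OF u R X triangle L1]
  note P2 = reversed_pedal_inverse[OF u(2,3,1) R X(2,3,1) tri(1)
      pedal_positive_cyclic[OF L2(1)] pedal_similar_cyclic[OF L2(2)], unfolded ax]
  note P3 = reversed_pedal_inverse[OF u(3,1,2) R X(3,1,2) tri(2)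
      pedal_positive_cyclic[OF pedal_positive_cyclic[OF L3(1)]]
      pedal_similar_cyclic[OF pedal_similar_cyclic[OF L3(2)]], unfolded ax]

  have neg: "pedal_negative A B C (inverse_point Z R M) \<and>
      pedal_similar_some_order A B C (inverse_point Z R M)"
    if "M \<noteq> Z" "pedal_positive A B C M" "pedal_similar A B C M U V W" "{U, V, W} = {A, B, C}" for M U V W
    using pedal_triangle_inverse[OF u R X triangle that(1-3)] that(4)
    unfolding pedal_similar_def pedal_similar_some_order_def similar_some_order_def by blast
  have "\<forall>M \<in> {\<Omega>1, \<Omega>2, L1, L2, L3} - {Z}.
       pedal_negative A B C (inverse_point Z R M) \<and>
       pedal_similar_some_order A B C (inverse_point Z R M)"
    using neg[OF _ O1(3,4)] neg[OF _ O2'] neg[OF _ L1] neg[OF _ L2] neg[OF _ L3]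
    by (auto simp: insert_commute)
  moreover have "\<forall>M \<in> {\<Omega>1, \<Omega>2, L1, L2, L3} - {Z}. inverse_point Z R M \<in> ?l"
    using O1(2) O2(2) P1(2) P2(2) P3(2) by auto
  moreover have "is_line ?l" by (rule is_line_lemoine_axis[OF u E R])
  moreover have "dist A B = dist A C \<longrightarrow> parallel_lines ?l (affine hull {B, C})"
    using lemoine_axis_parallel_base[OF u d E R X] by blast
  moreover have "dist B C = dist B A \<longrightarrow> parallel_lines ?l (affine hull {C, A})"
    using lemoine_axis_parallel_base[OF u(2,3,1) d(2,3,1) E'(1) R X(2,3,1)] unfolding ax by blast
  moreover have "dist C A = dist C B \<longrightarrow> parallel_lines ?l (affine hull {A, B})"
    using lemoine_axis_parallel_base[OF u(3,1,2) d(3,1,2) E'(2) R X(3,1,2)] unfolding ax by blast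
  ultimately show ?thesis using O1(1) O2(1) P1(1) P2(1) P3(1) by blast
qed

end
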